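(* Let $N=2^n$, let $B:\mathbb{F}_2^n\to\mathbb{F}_2^n$ be a permutation and let $w\in\mathbb{F}_2^n$. The quantum algorithm MACSample (described in the context), given the unitary oracle $U_B:|x\rangle\mapsto|B(x)\rangle$, makes at most three queries to $U_B$ in expectation, and outputs a non-zero pair of masks $(\alpha,\beta)$ with probability $\dfrac{C_w(\alpha,\beta)^2}{N(N-1)}$. If line 8 (the discard-and-repeat step) is removed, the algorithm always makes two queries to $U_B$ and outputs a pair of masks $(\alpha,\beta)$ with probability $\dfrac{C_w(\alpha,\beta)^2}{N^2}$.
   Context: For a permutation $B:\mathbb{F}_2^n\to\mathbb{F}_2^n$, the masked auto-correlation is $$C_w(\alpha,\beta)=\frac{1}{\sqrt N}\sum_{x\in\mathbb{F}_2^n}(-1)^{\alpha\cdot B(x)\,\oplus\,\beta\cdot B(x\oplus w)},\qquad \alpha,\beta\in\mathbb{F}_2^n,\ N=2^n .$$ A non-zero pair means both $\alpha\ne0^n$ and $\beta\neq 0^n$. Algorithm MACSample, on input $w$: (1) initialise three $n$-qubit registers as $|w\rangle|0^n\rangle|0^n\rangle$; (2) apply the Hadamard transform $H^{\otimes n}$ to register 2; (3) apply bitwise CNOT from register 2 (control) to register 3 (target); (4) apply bitwise CNOT from register 1 to register 3; (5) apply $U_B$ to register 2 and $U_B$ to register 3 (two queries); (6) apply $H^{\otimes n}$ to registers 2 and 3; (7) measure registers 2 and 3 in the computational basis, obtaining $(\alpha,\beta)$; (8) if exactly one of $\alpha,\beta$ equals $0^n$, or both do, discard and repeat from the start; (9)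 return $(\alpha,\beta)$.
   Formalization: The bound of three expected queries is stated only for n ≥ 2, since for n = 1 the expected number is 2N/(N−1) = 4; n = 0 is excluded, since there N(N−1) = 0 and the loop never stops. All other claims are for every n ≥ 1. *)

theory Defs
  imports "HOL-Library.Z2" "HOL-Analysis.Analysis" "HOL-Probability.Probability"
begin

instance bit :: finite
proof
  have "(UNIV :: bit set) = {0, 1}"
    by (auto intro: bit.exhaust)
  then show "finite (UNIV :: bit set)"
    by (metis finite.emptyI finite_insert)
qed


subsection \<open>Masked auto-correlation\<close>

text \<open>
  Bit strings of length \<open>n\<close> are vectors \<open>bit ^ 'n\<close> over the two-element field, with
  \<open>n = CARD('n) \<ge> 1\<close>; vector addition is bitwise exclusive or.
\<close>

definition bdot :: "bit ^ 'n \<Rightarrow> bit ^ 'n \<Rightarrow> bit" where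
  "bdot x y = (\<Sum>i\<in>UNIV. x $ i * y $ i)"

definition bsign :: "bit \<Rightarrow> real" where
  "bsign b = (if b = 1 then -1 else 1)"

definition masked_autocorrelation ::
    "(bit ^ 'n \<Rightarrow> bit ^ 'n) \<Rightarrow> bit ^ 'n \<Rightarrow> bit ^ 'n \<Rightarrow> bit ^ 'n \<Rightarrow> real" where
  "masked_autocorrelation B w \<alpha> \<beta> =
     1 / sqrt (2 ^ CARD('n)) * (\<Sum>x\<in>UNIV. bsign (bdot \<alpha> (B x) + bdot \<beta> (B (x + w))))"


subsection \<open>Oracle circuits on three registers\<close>

datatype reg = R1 | R2 | R3

lemma UNIV_reg: "(UNIV :: reg set) = {R1, R2, R3}"
  by (auto intro: reg.exhaust)

instance reg :: finite
  by standard (simp add: UNIV_reg)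

text \<open>
  A computational basis state assigns a bit string to each register; a state vector is the
  vector of its amplitudes. Operators are matrices with rows indexed by the output basis state.
\<close>

type_synonym 'n basis = "reg \<Rightarrow> bit ^ 'n"
type_synonym 'n state = "complex ^ 'n basis"
type_synonym 'n operator = "complex ^ (bit ^ 'n) ^ (bit ^ 'n)"

definition ket :: "'a \<Rightarrow> complex ^ 'a" where
  "ket x = (\<chi> y. if y = x then 1 else 0)"

text \<open>The linear extension of \<open>|x\<rangle> \<mapsto> |f x\<rangle>\<close>; the oracle \<open>U\<^sub>B\<close> is \<open>basis_op B\<close>.\<close>

definition basis_op :: "('a \<Rightarrow> 'a) \<Rightarrow> complex ^ 'a ^ 'a" where
  "basis_op f = (\<chi> y x. if y = f x then 1 else 0)"

definition hadamard_gate :: "complex ^ bit ^ bit" where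
  "hadamard_gate = (\<chi> b a. (if a = 1 \<and> b = 1 then -1 else 1) / complex_of_real (sqrt 2))"

text \<open>The tensor power of the one-qubit gate over the qubits of a register.\<close>

definition hadamard :: "('n::finite) operator" where
  "hadamard = (\<chi> y x. \<Prod>i\<in>UNIV. hadamard_gate $ (y $ i) $ (x $ i))"

text \<open>\<open>A\<close> on register \<open>r\<close>, tensored with the identity on the other registers.\<close>

definition on_reg :: "reg \<Rightarrow> ('n::finite) operator \<Rightarrow> complex ^ 'n basis ^ 'n basis" where
  "on_reg r A = (\<chi> y x. if \<forall>s. s \<noteq> r \<longrightarrow> y s = x s then A $ y r $ x r else 0)"

text \<open>
  \<open>CNOT r s\<close> has control \<open>r\<close> and target \<open>s\<close>; it is meant for \<open>r \<noteq> s\<close> only.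
\<close>

datatype gate = Hadamard reg | CNOT reg reg | Oracle reg

primrec gate_op :: "('n::finite) operator \<Rightarrow> gate \<Rightarrow> complex ^ 'n basis ^ 'n basis" where
  "gate_op U (Hadamard r) = on_reg r hadamard"
| "gate_op U (CNOT r s) = basis_op (\<lambda>x. x(s := x s + x r))"
| "gate_op U (Oracle r) = on_reg r U"

primrec gate_queries :: "gate \<Rightarrow> nat" where
  "gate_queries (Hadamard r) = 0"
| "gate_queries (CNOT r s) = 0"
| "gate_queries (Oracle r) = 1"

text \<open>Execution keeps the current state together with the number of oracle queries made.\<close>

definition run_circuit :: "('n::finite) operator \<Rightarrow> gate list \<Rightarrow> ('n::finite) state \<Rightarrow> ('n::finite) state \<times> nat" where
  "run_circuit U gs \<psi> =
     fold (\<lambda>g (\<phi>, k). (gate_op U g *v \<phi>, k + gate_queries g)) gs (\<psi>, 0)"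

text \<open>
  Measurement of the second and third register by the Born rule. \<^const>\<open>embed_pmf\<close> is only
  meaningful for weights summing to one, that is, for normalised \<open>\<psi>\<close>.
\<close>

definition measure_R2_R3 :: "('n::finite) state \<Rightarrow> ((bit ^ 'n) \<times> (bit ^ 'n)) pmf" where
  "measure_R2_R3 \<psi> =
     embed_pmf (\<lambda>(\<alpha>, \<beta>). \<Sum>x | x R2 = \<alpha> \<and> x R3 = \<beta>. (cmod (\<psi> $ x))\<^sup>2)"


subsection \<open>The sampling algorithm\<close>

definition mac_circuit :: "gate list" where
  "mac_circuit =
     [Hadamard R2, CNOT R2 R3, CNOT R1 R3, Oracle R2, Oracle R3, Hadamard R2, Hadamard R3]"

definition mac_init :: "bit ^ 'n \<Rightarrow> ('n::finite) state" where
  "mac_init w = ket (\<lambda>r. case r of R1 \<Rightarrow> w | R2 \<Rightarrow> 0 | R3 \<Rightarrow> 0)"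

text \<open>
  A single pass without the discard-and-repeat step: the joint distribution of the measured pair
  and the number of queries.
\<close>

definition mac_attempt ::
    "('n::finite) operator \<Rightarrow> bit ^ 'n \<Rightarrow> (((bit ^ 'n) \<times> (bit ^ 'n)) \<times> nat) pmf" where
  "mac_attempt U w =
     (let (\<psi>, k) = run_circuit U mac_circuit (mac_init w)
      in map_pmf (\<lambda>m. (m, k)) (measure_R2_R3 \<psi>))"

text \<open>
  The full algorithm. The last argument accumulates the queries of the discarded passes;
  the missing mass of the subprobability distribution is the probability of running forever.
\<close>

partial_function (spmf) mac_sample_from ::
    "('n::finite) operator \<Rightarrow> bit ^ 'n \<Rightarrow> nat \<Rightarrow> (((bit ^ 'n) \<times> (bit ^ 'n)) \<times> nat) spmf" where
  "mac_sample_from U w q =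
     bind_spmf (spmf_of_pmf (mac_attempt U w))
       (\<lambda>((\<alpha>, \<beta>), k).
          if \<alpha> = 0 \<or> \<beta> = 0 then mac_sample_from U w (q + k)
          else return_spmf ((\<alpha>, \<beta>), q + k))"

definition mac_sample ::
    "('n::finite) operator \<Rightarrow> bit ^ 'n \<Rightarrow> (((bit ^ 'n) \<times> (bit ^ 'n)) \<times> nat) spmf" where
  "mac_sample U w = mac_sample_from U w 0"

text \<open>
  Runs that never stop count as infinitely many queries, instead of being ignored.
\<close>

definition expected_queries :: "('a \<times> nat) spmf \<Rightarrow> ennreal" where
  "expected_queries p =
     (\<integral>\<^sup>+ r. (case r of None \<Rightarrow> \<infinity> | Some (_, k) \<Rightarrow> of_nat k) \<partial>measure_pmf p)"

end

theory Submission
  imports Defs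
begin

text \<open>
  One pass leaves register 1 in the state \<open>w\<close> and gives the pair \<open>(\<alpha>, \<beta>)\<close> the amplitude \<open>C\<^sub>w(\<alpha>, \<beta>) / N\<close>.
  Parseval's identity shows that the squared amplitudes sum to one; since \<open>B\<close> is a permutation,
  \<open>C\<^sub>w(\<alpha>, 0)\<close> and \<open>C\<^sub>w(0, \<beta>)\<close> vanish except for \<open>C\<^sub>w(0, 0)\<^sup>2 = N\<close>, so a pass is discarded with
  probability exactly \<open>1/N\<close>. Expectations over the whole loop, as functions of the number \<open>q\<close> of
  queries made so far, therefore satisfy a recursion that contracts with factor \<open>1/N\<close>, and every
  bounded solution of it is determined; this gives the output distribution, and \<open>2N/(N-1) \<le> 3\<close>
  expected queries.
\<close>

text \<open>These two rules turn the field operations on bits into Boolean connectives, on which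
  \<open>algebra_simps\<close> and the sum rules no longer apply.\<close>

declare add_bit_eq_xor [simp del] mult_bit_eq_and [simp del]

section \<open>Characters of the group of bit strings\<close>

lemma bit_add_self [simp]: "(x::bit ^ 'n) + x = 0"
proof -
  have "b + b = 0" for b :: bit
    by (cases b) simp_all
  then show ?thesis by (simp add: vec_eq_iff)
qed

lemma bit_add_add_cancel [simp]: "(x::bit ^ 'n) + y + y = x"
  by (simp add: add.assoc)

lemma bsign_add: "bsign (a + b) = bsign a * bsign b"
  by (cases a; cases b) (simp_all add: bsign_def)

lemma bsign_sum: "finite A \<Longrightarrow> bsign (\<Sum>i\<in>A. f i) = (\<Prod>i\<in>A. bsign (f i))"
  by (induction A rule: finite_induct) (simp_all add: bsign_add, simp add: bsign_def)

lemma bsign_square [simp]: "bsign a * bsign a = 1"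
  by (simp add: bsign_def)

lemma bdot_0_left [simp]: "bdot 0 x = 0"
  and bdot_0_right [simp]: "bdot x 0 = 0"
  by (simp_all add: bdot_def)

lemma bdot_add_right: "bdot \<alpha> (x + y) = bdot \<alpha> x + bdot \<alpha> y"
  by (simp add: bdot_def algebra_simps sum.distrib)

lemma bdot_commute: "bdot x y = bdot y x"
  by (simp add: bdot_def mult.commute)

lemma card_bit [simp]: "CARD(bit) = 2"
proof -
  have "(UNIV :: bit set) = {0, 1}"
    by (auto intro: bit.exhaust)
  then have "CARD(bit) = card {0, 1 :: bit}"
    by (rule arg_cong)
  then show ?thesis by simp
qed

text \<open>If \<open>\<alpha> $ i = 1\<close>, translation by the unit vector
  \<open>axis i 1\<close> permutes the bit strings and flips the sign of every summand, so the sum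
  equals its own negative.\<close>

lemma character_sum:
  "(\<Sum>x\<in>UNIV. bsign (bdot \<alpha> (x :: bit ^ 'n))) = (if \<alpha> = 0 then 2 ^ CARD('n) else 0)"
proof (cases "\<alpha> = 0")
  case True
  then show ?thesis by (simp add: bsign_def)
next
  case False
  then obtain i where i: "\<alpha> $ i = 1"
    by (auto simp: vec_eq_iff)
  have "bdot \<alpha> (axis i 1) = 1"
    by (simp add: bdot_def axis_def if_distrib[of "\<lambda>t. _ * t"] i cong: if_cong)
  then have shift: "bdot \<alpha> (x + axis i 1) = bdot \<alpha> x + 1" for x
    by (simp add: bdot_add_right)
  have "(\<Sum>x\<in>UNIV. bsign (bdot \<alpha> x)) = (\<Sum>x\<in>UNIV. bsign (bdot \<alpha> (x + axis i 1)))"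
    by (rule sum.reindex_bij_witness[where i = "\<lambda>x. x + axis i 1" and j = "\<lambda>x. x + axis i 1"])
      simp_all
  also have "\<dots> = - (\<Sum>x\<in>UNIV. bsign (bdot \<alpha> x))"
    by (simp add: shift bsign_add sum_negf) (simp add: bsign_def sum_negf)
  finally show ?thesis using False by simp
qed

text \<open>Expanding the square, the two characters at x and y merge into one character evaluated
  at x + y. Summing over \<open>\<alpha>\<close> first leaves only the terms with x + y = 0, that
  is, the diagonal.\<close>

lemma parseval:
  fixes g :: "bit ^ 'n \<Rightarrow> real"
  shows "(\<Sum>\<alpha>\<in>UNIV. (\<Sum>x\<in>UNIV. bsign (bdot \<alpha> x) * g x)\<^sup>2) = 2 ^ CARD('n) * (\<Sum>x\<in>UNIV. (g x)\<^sup>2)"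
proof -
  have add_eq_0: "x + y = 0 \<longleftrightarrow> y = x" for x y :: "bit ^ 'n"
    by (metis bit_add_self bit_add_add_cancel add_0 add.commute)
  have "(\<Sum>\<alpha>\<in>UNIV. (\<Sum>x\<in>UNIV. bsign (bdot \<alpha> x) * g x)\<^sup>2) =
      (\<Sum>\<alpha>\<in>UNIV. \<Sum>x\<in>UNIV. \<Sum>y\<in>UNIV. bsign (bdot (x + y) \<alpha>) * (g x * g y))"
    by (simp add: power2_eq_square sum_product bdot_commute[of "_ + _"] bdot_add_right bsign_add
        mult_ac)
  also have "\<dots> = (\<Sum>x\<in>UNIV. \<Sum>y\<in>UNIV. (\<Sum>\<alpha>\<in>UNIV. bsign (bdot (x + y) \<alpha>)) * (g x * g y))"
    by (subst sum.swap, rule sum.cong[OF refl], subst sum.swap) (simp add: sum_distrib_right)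
  also have "\<dots> = (\<Sum>x\<in>UNIV. 2 ^ CARD('n) * (g x)\<^sup>2)"
    by (simp add: character_sum add_eq_0 if_distrib[of "\<lambda>t. t * _"] power2_eq_square cong: if_cong)
  finally show ?thesis by (simp add: sum_distrib_left)
qed

section \<open>Square sums and zero masks of the masked auto-correlation\<close>

text \<open>For fixed \<open>\<beta>\<close>, substituting B x for x turns the auto-correlation into
  the Walsh transform of a function with values 1 and -1, to which Parseval's identity
  applies.\<close>

lemma masked_autocorrelation_square_sum:
  fixes B :: "bit ^ 'n \<Rightarrow> bit ^ 'n"
  assumes "bij B"
  shows "(\<Sum>\<alpha>\<in>UNIV. (masked_autocorrelation B w \<alpha> \<beta>)\<^sup>2) = 2 ^ CARD('n)"
proof -
  define g where "g x = bsign (bdot \<beta> (B (inv B x + w)))" for x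
  have "(\<Sum>x\<in>UNIV. bsign (bdot \<alpha> (B x) + bdot \<beta> (B (x + w)))) =
      (\<Sum>x\<in>UNIV. bsign (bdot \<alpha> x) * g x)" for \<alpha>
    using assms unfolding g_def
    by (intro sum.reindex_bij_witness[where i = "inv B" and j = B])
      (simp_all add: bsign_add bij_is_inj bij_is_surj surj_f_inv_f)
  then have "(\<Sum>\<alpha>\<in>UNIV. (masked_autocorrelation B w \<alpha> \<beta>)\<^sup>2) =
      1 / 2 ^ CARD('n) * (\<Sum>\<alpha>\<in>UNIV. (\<Sum>x\<in>UNIV. bsign (bdot \<alpha> x) * g x)\<^sup>2)"
    by (simp add: masked_autocorrelation_def power_divide flip: sum_divide_distrib)
  also have "\<dots> = 2 ^ CARD('n)"
    unfolding parseval by (simp add: g_def power2_eq_square)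
  finally show ?thesis .
qed

text \<open>A zero mask removes one of the two sign factors. The argument of the other runs through
  all bit strings once, so a plain character sum remains.\<close>

lemma masked_autocorrelation_0_left:
  fixes B :: "bit ^ 'n \<Rightarrow> bit ^ 'n"
  assumes "bij B"
  shows "masked_autocorrelation B w 0 \<beta> = (if \<beta> = 0 then sqrt (2 ^ CARD('n)) else 0)"
proof -
  have "(\<Sum>x\<in>UNIV. bsign (bdot \<beta> (B (x + w)))) = (\<Sum>x\<in>UNIV. bsign (bdot \<beta> x))"
    using assms
    by (intro sum.reindex_bij_witness[where i = "\<lambda>x. inv B x + w" and j = "\<lambda>x. B (x + w)"])
      (simp_all add: bij_is_inj bij_is_surj surj_f_inv_f)
  then show ?thesis
    by (simp add: masked_autocorrelation_def character_sum real_div_sqrt)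
qed

lemma masked_autocorrelation_0_right:
  fixes B :: "bit ^ 'n \<Rightarrow> bit ^ 'n"
  assumes "bij B"
  shows "masked_autocorrelation B w \<alpha> 0 = (if \<alpha> = 0 then sqrt (2 ^ CARD('n)) else 0)"
proof -
  have "(\<Sum>x\<in>UNIV. bsign (bdot \<alpha> (B x))) = (\<Sum>x\<in>UNIV. bsign (bdot \<alpha> x))"
    using assms
    by (intro sum.reindex_bij_witness[where i = "inv B" and j = B])
      (simp_all add: bij_is_inj bij_is_surj surj_f_inv_f)
  then show ?thesis
    by (simp add: masked_autocorrelation_def character_sum real_div_sqrt)
qed

section \<open>Amplitudes after a single gate\<close>

lemma hadamard_nth:
  "(hadamard :: ('n::finite) operator) $ y $ x =
    complex_of_real (bsign (bdot y x) / sqrt (2 ^ CARD('n)))"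
proof -
  have gate: "hadamard_gate $ b $ a = complex_of_real (bsign (b * a) / sqrt 2)" for a b
    by (cases a; cases b) (simp_all add: hadamard_gate_def bsign_def)
  show ?thesis
    by (simp add: hadamard_def gate bdot_def bsign_sum prod_dividef real_sqrt_power
        del: of_real_divide flip: of_real_prod)
qed

text \<open>A matrix entry is nonzero only between basis states that agree outside \<open>r\<close>;
  those agreeing with \<open>y\<close> there are exactly the updates of \<open>y\<close> at
  \<open>r\<close>.\<close>

lemma on_reg_mult_nth:
  "(on_reg r A *v \<psi>) $ y = (\<Sum>b\<in>UNIV. A $ y r $ b * \<psi> $ (y(r := b)))"
proof -
  have "(on_reg r A *v \<psi>) $ y =
      (\<Sum>x\<in>UNIV. (if \<forall>s. s \<noteq> r \<longrightarrow> y s = x s then A $ y r $ x r else 0) * \<psi> $ x)"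
    by (simp add: on_reg_def matrix_vector_mult_def)
  also have "\<dots> = (\<Sum>x\<in>range (\<lambda>b. y(r := b)).
      (if \<forall>s. s \<noteq> r \<longrightarrow> y s = x s then A $ y r $ x r else 0) * \<psi> $ x)"
  proof (rule sum.mono_neutral_right)
    show "\<forall>x\<in>UNIV - range (\<lambda>b. y(r := b)).
        (if \<forall>s. s \<noteq> r \<longrightarrow> y s = x s then A $ y r $ x r else 0) * \<psi> $ x = 0"
    proof
      fix x assume x: "x \<in> UNIV - range (\<lambda>b. y(r := b))"
      have "\<not> (\<forall>s. s \<noteq> r \<longrightarrow> y s = x s)"
      proof
        assume "\<forall>s. s \<noteq> r \<longrightarrow> y s = x s"
        then have "x = y(r := x r)" by auto
        then show False using x by blast
      qed
      then show "(if \<forall>s. s \<noteq> r \<longrightarrow> y s = x s then A $ y r $ x r else 0) * \<psi> $ x = 0"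
        by (simp only: if_False mult_zero_left)
    qed
  qed simp_all
  also have "\<dots> = (\<Sum>b\<in>UNIV. A $ y r $ b * \<psi> $ (y(r := b)))"
    by (subst sum.reindex) (auto simp: inj_def fun_eq_iff split: if_splits)
  finally show ?thesis .
qed

lemma basis_op_mult_nth:
  assumes "\<And>x. g (f x) = x" and "\<And>x. f (g x) = x"
  shows "(basis_op f *v \<psi>) $ y = \<psi> $ g y"
proof -
  have "y = f x \<longleftrightarrow> x = g y" for x
    using assms by metis
  then show ?thesis
    by (simp add: basis_op_def matrix_vector_mult_def if_distrib[of "\<lambda>t. t * _"] cong: if_cong)
qed

text \<open>In characteristic 2, and with control and target distinct, the gate is its own
  inverse.\<close>

lemma CNOT_mult_nth:
  assumes "r \<noteq> s"
  shows "(gate_op U (CNOT r s) *v \<psi>) $ y = \<psi> $ (y(s := y s + y r))"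
  using assms by (simp add: basis_op_mult_nth[where g = "\<lambda>x. x(s := x s + x r)"])

lemma on_reg_basis_op_mult_nth:
  assumes "bij B"
  shows "(on_reg r (basis_op B) *v \<psi>) $ y = \<psi> $ (y(r := inv B (y r)))"
proof -
  have "y r = B b \<longleftrightarrow> b = inv B (y r)" for b
    using assms by (metis bij_inv_eq_iff)
  then show ?thesis
    by (simp add: on_reg_mult_nth basis_op_def if_distrib[of "\<lambda>t. t * _"] cong: if_cong)
qed

section \<open>The circuit and the outcome of one pass\<close>

lemma run_mac_circuit:
  fixes B :: "bit ^ 'n \<Rightarrow> bit ^ 'n"
  assumes "bij B"
  obtains \<psi> where "run_circuit (basis_op B) mac_circuit (mac_init w) = (\<psi>, 2)"
    and "\<And>y. \<psi> $ y = (if y R1 = w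
      then complex_of_real (masked_autocorrelation B w (y R2) (y R3) / 2 ^ CARD('n)) else 0)"
proof -
  let ?U = "basis_op B"
  let ?N = "2 ^ CARD('n) :: real"
  \<comment> \<open>The index of each state counts the gates applied so far.\<close>
  define \<psi>1 where "\<psi>1 = on_reg R2 hadamard *v mac_init w"
  define \<psi>3 where "\<psi>3 = gate_op ?U (CNOT R1 R3) *v (gate_op ?U (CNOT R2 R3) *v \<psi>1)"
  define \<psi>5 where "\<psi>5 = on_reg R3 ?U *v (on_reg R2 ?U *v \<psi>3)"
  define \<psi>6 where "\<psi>6 = on_reg R2 hadamard *v \<psi>5"
  define \<psi>7 where "\<psi>7 = on_reg R3 hadamard *v \<psi>6"
  have init: "mac_init w $ y = (if y R1 = w \<and> y R2 = 0 \<and> y R3 = 0 then 1 else 0)" for y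
  proof -
    have "y = (\<lambda>r. case r of R1 \<Rightarrow> w | R2 \<Rightarrow> 0 | R3 \<Rightarrow> 0) \<longleftrightarrow> y R1 = w \<and> y R2 = 0 \<and> y R3 = 0"
      (is "y = ?f \<longleftrightarrow> ?R")
    proof
      assume ?R
      show "y = ?f"
      proof
        fix r show "y r = ?f r"
          using \<open>?R\<close> by (cases r) simp_all
      qed
    qed simp
    then show ?thesis by (simp add: mac_init_def ket_def)
  qed
  have 1: "\<psi>1 $ y = (if y R1 = w \<and> y R3 = 0 then complex_of_real (1 / sqrt ?N) else 0)" for y
    by (cases "y R1 = w"; cases "y R3 = 0")
      (simp_all add: \<psi>1_def on_reg_mult_nth init hadamard_nth if_distrib[of "\<lambda>t. _ * t"]
        bsign_def cong: if_cong)
  have 3: "\<psi>3 $ y = (if y R1 = w \<and> y R3 = y R2 + w then complex_of_real (1 / sqrt ?N) else 0)" for y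
  proof -
    \<comment> \<open>Pulling \<open>y\<close> back through both CNOTs changes only register 3,
      which must then hold its initial value 0.\<close>
    have "y R3 + y R1 + y R2 = 0 \<longleftrightarrow> y R3 = y R2 + y R1"
      by (metis bit_add_self bit_add_add_cancel add.assoc add.commute)
    then show ?thesis
      unfolding \<psi>3_def by (auto simp add: CNOT_mult_nth 1 simp del: gate_op.simps)
  qed
  have 5: "\<psi>5 $ y = (if y R1 = w \<and> inv B (y R3) = inv B (y R2) + w
      then complex_of_real (1 / sqrt ?N) else 0)" for y
    by (simp add: \<psi>5_def on_reg_basis_op_mult_nth[OF assms] 3)
  have 6: "\<psi>6 $ y = (\<Sum>x\<in>UNIV. if y R1 = w \<and> y R3 = B (x + w)
      then complex_of_real (bsign (bdot (y R2) (B x)) / ?N) else 0)" for y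
  proof -
    have iff: "inv B (y R3) = x + w \<longleftrightarrow> y R3 = B (x + w)" for x
      using assms by (metis bij_inv_eq_iff)
    have "\<psi>6 $ y = (\<Sum>a\<in>UNIV. if y R1 = w \<and> inv B (y R3) = inv B a + w
        then complex_of_real (bsign (bdot (y R2) a) / ?N) else 0)"
      by (simp add: \<psi>6_def on_reg_mult_nth 5 hadamard_nth if_distrib[of "\<lambda>t. _ * t"]
          flip: of_real_mult cong: if_cong)
    \<comment> \<open>Substituting a = B x returns to the oracle's input and removes the inverse
      from register 2.\<close>
    also have "\<dots> = (\<Sum>x\<in>UNIV. if y R1 = w \<and> inv B (y R3) = x + w
        then complex_of_real (bsign (bdot (y R2) (B x)) / ?N) else 0)"
      using assms
      by (intro sum.reindex_bij_witness[where i = B and j = "inv B"])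
        (simp_all add: bij_is_inj bij_is_surj surj_f_inv_f)
    finally show ?thesis
      unfolding iff .
  qed
  have 7: "\<psi>7 $ y = (if y R1 = w
      then complex_of_real (masked_autocorrelation B w (y R2) (y R3) / ?N) else 0)" for y
  proof (cases "y R1 = w")
    case True
    \<comment> \<open>The three Hadamard transforms contribute 1 / sqrt N each. One of these factors
      is the normalisation of the auto-correlation, so 1 / N remains.\<close>
    have "\<psi>7 $ y = (\<Sum>b\<in>UNIV. \<Sum>x\<in>UNIV. if b = B (x + w) then complex_of_real
        (bsign (bdot (y R3) b) * bsign (bdot (y R2) (B x)) / (sqrt ?N * ?N)) else 0)"
      using True
      by (simp add: \<psi>7_def on_reg_mult_nth 6 hadamard_nth sum_distrib_left
          if_distrib[of "\<lambda>t. _ * t"] cong: if_cong)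
    also have "\<dots> = (\<Sum>x\<in>UNIV. complex_of_real
        (bsign (bdot (y R3) (B (x + w))) * bsign (bdot (y R2) (B x)) / (sqrt ?N * ?N)))"
      by (subst sum.swap) simp
    also have "\<dots> = complex_of_real (masked_autocorrelation B w (y R2) (y R3) / ?N)"
      unfolding masked_autocorrelation_def bsign_add of_real_sum[symmetric]
      by (simp add: sum_divide_distrib[symmetric] mult.commute)
    finally show ?thesis using True by simp
  next
    case False
    then show ?thesis by (simp add: \<psi>7_def on_reg_mult_nth 6)
  qed
  have "run_circuit ?U mac_circuit (mac_init w) = (\<psi>7, 2)"
    by (simp add: run_circuit_def mac_circuit_def \<psi>7_def \<psi>6_def \<psi>5_def \<psi>3_def \<psi>1_def)
  then show ?thesis using 7 that by blast
qed

lemma mac_attempt_eq: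
  fixes B :: "bit ^ 'n \<Rightarrow> bit ^ 'n"
  assumes "bij B"
  obtains P where "mac_attempt (basis_op B) w = map_pmf (\<lambda>m. (m, 2)) P"
    and "\<And>\<alpha> \<beta>. pmf P (\<alpha>, \<beta>) = (masked_autocorrelation B w \<alpha> \<beta>)\<^sup>2 / (2 ^ CARD('n))\<^sup>2"
proof -
  let ?N = "2 ^ CARD('n) :: real"
  let ?C = "masked_autocorrelation B w"
  obtain \<psi> where run: "run_circuit (basis_op B) mac_circuit (mac_init w) = (\<psi>, 2)"
    and amp: "\<And>y. \<psi> $ y = (if y R1 = w then complex_of_real (?C (y R2) (y R3) / ?N) else 0)"
    using run_mac_circuit[OF assms] by blast
  have weight: "(\<Sum>x | x R2 = \<alpha> \<and> x R3 = \<beta>. (cmod (\<psi> $ x))\<^sup>2) = (?C \<alpha> \<beta>)\<^sup>2 / ?N\<^sup>2" for \<alpha> \<beta>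
  proof -
    \<comment> \<open>Register 1 holds \<open>w\<close> in every basis state of nonzero amplitude,
      so fixing the other two registers leaves a single contribution.\<close>
    let ?y = "\<lambda>r. case r of R1 \<Rightarrow> w | R2 \<Rightarrow> \<alpha> | R3 \<Rightarrow> \<beta>"
    have "(\<Sum>x | x R2 = \<alpha> \<and> x R3 = \<beta>. (cmod (\<psi> $ x))\<^sup>2) = (\<Sum>x\<in>{?y}. (cmod (\<psi> $ x))\<^sup>2)"
      by (rule sum.mono_neutral_right)
        (auto simp: amp fun_eq_iff split: reg.splits if_splits)
    also have "\<dots> = (?C \<alpha> \<beta>)\<^sup>2 / ?N\<^sup>2"
      by (simp add: amp norm_divide norm_power power_divide)
    finally show ?thesis .
  qed
  let ?P = "measure_R2_R3 \<psi>"
  have "pmf ?P (\<alpha>, \<beta>) = (?C \<alpha> \<beta>)\<^sup>2 / ?N\<^sup>2" for \<alpha> \<beta>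
    unfolding measure_R2_R3_def weight
  proof (subst pmf_embed_pmf)
    \<comment> \<open>Normalisation, which \<open>embed_pmf\<close> requires: each of the N values
      of \<open>\<beta>\<close> contributes N / N^2.\<close>
    have "(\<Sum>(\<alpha>, \<beta>)\<in>UNIV. (?C \<alpha> \<beta>)\<^sup>2 / ?N\<^sup>2) = (\<Sum>\<beta>\<in>UNIV. \<Sum>\<alpha>\<in>UNIV. (?C \<alpha> \<beta>)\<^sup>2 / ?N\<^sup>2)"
      by (subst sum.swap) (simp add: sum.cartesian_product)
    also have "\<dots> = (\<Sum>\<beta>\<in>(UNIV :: (bit ^ 'n) set). ?N / ?N\<^sup>2)"
      using masked_autocorrelation_square_sum[OF assms, of w]
      by (simp flip: sum_divide_distrib)
    also have "\<dots> = 1"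
      by (simp add: power2_eq_square)
    finally show "(\<integral>\<^sup>+ x. ennreal (case x of (\<alpha>, \<beta>) \<Rightarrow> (?C \<alpha> \<beta>)\<^sup>2 / ?N\<^sup>2) \<partial>count_space UNIV) = 1"
      by (subst nn_integral_count_space_finite) (auto simp: sum_ennreal split: prod.splits)
  qed auto
  moreover have "mac_attempt (basis_op B) w = map_pmf (\<lambda>m. (m, 2)) ?P"
    by (simp add: mac_attempt_def run)
  ultimately show ?thesis using that by blast
qed

section \<open>Bounded solutions of contracting recursions\<close>

text \<open>Iterating j times bounds \<open>y q\<close> by \<open>r ^ j * M\<close>, because
  \<open>M\<close> is uniform in the shifted argument; this bound tends to 0.\<close>

lemma contraction_nonpos:
  fixes y :: "nat \<Rightarrow> real"
  assumes "\<And>q. y q \<le> r * y (q + d)" and "\<And>q. y q \<le> M" and "0 \<le> r" "r < 1"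
  shows "y q \<le> 0"
proof -
  have "y q \<le> r ^ j * M" for j
  proof (induction j arbitrary: q)
    case 0
    then show ?case using assms(2) by simp
  next
    case (Suc j)
    have "y q \<le> r * y (q + d)" by (rule assms(1))
    also have "\<dots> \<le> r * (r ^ j * M)"
      using Suc assms(3) by (intro mult_left_mono)
    finally show ?case by (simp add: mult_ac)
  qed
  moreover have "(\<lambda>j. r ^ j * M) \<longlonglongrightarrow> 0 * M"
    using assms by (intro tendsto_intros LIMSEQ_power_zero) auto
  ultimately show ?thesis
    by (intro LIMSEQ_le_const[where X = "\<lambda>j. r ^ j * M"]) auto
qed

text \<open>The constant c solves the same recursion, so both differences x - c and c - x contract
  and are bounded above.\<close>

lemma contraction_fixed_point:
  fixes x :: "nat \<Rightarrow> real"
  assumes "\<And>q. x q = (1 - r) * c + r * x (q + d)" and "\<And>q. \<bar>x q\<bar> \<le> M" and "0 \<le> r" "r < 1"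
  shows "x q = c"
proof (rule antisym)
  have bnd: "x q - c \<le> M + \<bar>c\<bar>" "c - x q \<le> M + \<bar>c\<bar>" for q
    using assms(2)[of q] by linarith+
  have eq: "x q - c = r * (x (q + d) - c)" for q
    by (subst assms(1)) (simp add: algebra_simps)
  have "x q - c \<le> r * (x (q + d) - c)" for q
    using eq by (rule eq_refl)
  from contraction_nonpos[where y = "\<lambda>q. x q - c", OF this bnd(1) assms(3,4)]
  show "x q \<le> c" by simp
  have "c - x q \<le> r * (c - x (q + d))" for q
    using eq[of q] by (simp add: right_diff_distrib)
  from contraction_nonpos[where y = "\<lambda>q. c - x q", OF this bnd(2) assms(3,4)]
  show "c \<le> x q" by simp
qed

section \<open>Expectations over the loop and the output distribution\<close>

text \<open>The tower rule, taken from nonnegative integrals; boundedness gives the integrability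
  that carries it over to real expectations.\<close>

lemma expectation_bind_pmf:
  fixes f :: "'b \<Rightarrow> real"
  assumes f: "\<And>t. 0 \<le> f t" "\<And>t. f t \<le> M"
  shows "measure_pmf.expectation (bind_pmf p k) f =
    measure_pmf.expectation p (\<lambda>x. measure_pmf.expectation (k x) f)"
proof -
  have int: "integrable (measure_pmf q) f" for q
    using f by (intro measure_pmf.integrable_const_bound[where B = M]) simp_all
  have bound: "measure_pmf.expectation q f \<le> M" for q
    using f int by (intro measure_pmf.integral_le_const) simp_all
  have nonneg: "0 \<le> measure_pmf.expectation q f" for q
    using f by simp
  have int2: "integrable (measure_pmf p) (\<lambda>x. measure_pmf.expectation (k x) f)"
    using bound nonneg by (intro measure_pmf.integrable_const_bound[where B = M]) simp_all
  have "ennreal (measure_pmf.expectation (bind_pmf p k) f) =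
      (\<integral>\<^sup>+x. \<integral>\<^sup>+y. ennreal (f y) \<partial>k x \<partial>p)"
    using nn_integral_eq_integral[OF int, of "bind_pmf p k"] f(1) by simp
  also have "\<dots> = (\<integral>\<^sup>+x. ennreal (measure_pmf.expectation (k x) f) \<partial>p)"
    using nn_integral_eq_integral[OF int] f(1) by simp
  also have "\<dots> = ennreal (measure_pmf.expectation p (\<lambda>x. measure_pmf.expectation (k x) f))"
    using nn_integral_eq_integral[OF int2] nonneg by simp
  finally show ?thesis
    using nonneg by (simp add: integral_nonneg_AE)
qed

text \<open>The test function may charge non-terminating runs through its value at \<^term>\<open>None\<close>, so that
  almost sure termination needs no separate proof.\<close>

lemma mac_sample_from_expectation:
  fixes B :: "bit ^ 'n \<Rightarrow> bit ^ 'n" and f :: "(((bit ^ 'n) \<times> (bit ^ 'n)) \<times> nat) option \<Rightarrow> real"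
  assumes "bij B" and f: "\<And>t. 0 \<le> f t" "\<And>t. f t \<le> M"
  shows "measure_pmf.expectation (mac_sample_from (basis_op B) w q) f =
    (\<Sum>(\<alpha>, \<beta>)\<in>{(\<alpha>, \<beta>). \<alpha> \<noteq> 0 \<and> \<beta> \<noteq> 0}.
       (masked_autocorrelation B w \<alpha> \<beta>)\<^sup>2 / (2 ^ CARD('n))\<^sup>2 * f (Some ((\<alpha>, \<beta>), q + 2))) +
    1 / 2 ^ CARD('n) * measure_pmf.expectation (mac_sample_from (basis_op B) w (q + 2)) f"
proof -
  let ?N = "2 ^ CARD('n) :: real"
  let ?C = "masked_autocorrelation B w"
  let ?E = "\<lambda>q. measure_pmf.expectation (mac_sample_from (basis_op B) w q) f"
  let ?A = "{(\<alpha>, \<beta>). \<alpha> \<noteq> 0 \<and> \<beta> \<noteq> 0} :: ((bit ^ 'n) \<times> (bit ^ 'n)) set"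
  obtain P where P: "mac_attempt (basis_op B) w = map_pmf (\<lambda>m. (m, 2)) P"
    and "\<And>\<alpha> \<beta>. pmf P (\<alpha>, \<beta>) = (?C \<alpha> \<beta>)\<^sup>2 / ?N\<^sup>2"
    using mac_attempt_eq[OF assms(1)] by blast
  then have pmf_P: "pmf P m = (?C (fst m) (snd m))\<^sup>2 / ?N\<^sup>2" for m
    by (cases m) simp
  have split: "(\<Sum>m\<in>UNIV. g m) = (\<Sum>m\<in>?A. g m) + (\<Sum>m\<in>- ?A. g m)"
    for g :: "(bit ^ 'n) \<times> (bit ^ 'n) \<Rightarrow> real"
    by (subst add.commute) (simp add: sum.subset_diff[of ?A UNIV] Compl_eq_Diff_UNIV)
  have "mac_sample_from (basis_op B) w q = bind_pmf P (\<lambda>(\<alpha>, \<beta>).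
      if \<alpha> = 0 \<or> \<beta> = 0 then mac_sample_from (basis_op B) w (q + 2)
      else return_spmf ((\<alpha>, \<beta>), q + 2))"
    by (subst mac_sample_from.simps) (auto simp: P bind_map_pmf intro!: bind_pmf_cong)
  then have "?E q = (\<Sum>(\<alpha>, \<beta>)\<in>UNIV. (?C \<alpha> \<beta>)\<^sup>2 / ?N\<^sup>2 *
      (if \<alpha> = 0 \<or> \<beta> = 0 then ?E (q + 2) else f (Some ((\<alpha>, \<beta>), q + 2))))"
    by (simp add: expectation_bind_pmf[OF f] integral_measure_pmf[where A = UNIV] pmf_P split_def
        if_distrib[of measure_pmf] if_distrib[of "\<lambda>p. integral\<^sup>L p f"] cong: if_cong)
  also have "\<dots> = (\<Sum>(\<alpha>, \<beta>)\<in>?A. (?C \<alpha> \<beta>)\<^sup>2 / ?N\<^sup>2 * f (Some ((\<alpha>, \<beta>), q + 2))) +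
      (\<Sum>(\<alpha>, \<beta>)\<in>- ?A. (?C \<alpha> \<beta>)\<^sup>2 / ?N\<^sup>2 * ?E (q + 2))"
    unfolding split by (intro arg_cong2[where f = "(+)"] sum.cong) auto
  \<comment> \<open>Among the discarded pairs, those with exactly one zero mask have weight 0, so
    only (0, 0) ever causes a repetition.\<close>
  also have "(\<Sum>(\<alpha>, \<beta>)\<in>- ?A. (?C \<alpha> \<beta>)\<^sup>2 / ?N\<^sup>2 * ?E (q + 2)) =
      (\<Sum>(\<alpha>, \<beta>)\<in>{(0, 0)}. (?C \<alpha> \<beta>)\<^sup>2 / ?N\<^sup>2 * ?E (q + 2))"
    by (rule sum.mono_neutral_right)
      (auto simp: masked_autocorrelation_0_left masked_autocorrelation_0_right assms(1))
  also have "\<dots> = 1 / ?N * ?E (q + 2)"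
    by (simp add: masked_autocorrelation_0_left assms(1) power2_eq_square)
  finally show ?thesis .
qed

text \<open>The test function is the indicator of the output pair, which is 0 at
  \<open>None\<close>. The starting counter is arbitrary because each repetition shifts it.\<close>

lemma spmf_mac_sample_from:
  fixes B :: "bit ^ 'n \<Rightarrow> bit ^ 'n"
  assumes "bij B"
  shows "spmf (map_spmf fst (mac_sample_from (basis_op B) w q)) (\<alpha>, \<beta>) =
    (if \<alpha> \<noteq> 0 \<and> \<beta> \<noteq> 0
     then (masked_autocorrelation B w \<alpha> \<beta>)\<^sup>2 / (2 ^ CARD('n) * (2 ^ CARD('n) - 1)) else 0)"
proof -
  let ?N = "2 ^ CARD('n) :: real"
  let ?C = "masked_autocorrelation B w"
  let ?f = "\<lambda>t. indicat_real {t. map_option fst t = Some (\<alpha>, \<beta>)} t"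
  define x where "x q = spmf (map_spmf fst (mac_sample_from (basis_op B) w q)) (\<alpha>, \<beta>)" for q
  have N: "?N > 1"
    by simp
  have exp: "x q = measure_pmf.expectation (mac_sample_from (basis_op B) w q) ?f" for q
    by (simp add: x_def pmf_map vimage_def)
  \<comment> \<open>Chosen so that \<open>(1 - 1 / ?N) * c\<close> is the probability that a single
    pass returns the pair.\<close>
  define c where "c = (if \<alpha> \<noteq> 0 \<and> \<beta> \<noteq> 0 then (?C \<alpha> \<beta>)\<^sup>2 / (?N * (?N - 1)) else 0)"
  have "x q = (1 - 1 / ?N) * c + 1 / ?N * x (q + 2)" for q
  proof -
    have "(\<Sum>(a, b)\<in>{(\<alpha>, \<beta>). \<alpha> \<noteq> 0 \<and> \<beta> \<noteq> 0}. (?C a b)\<^sup>2 / ?N\<^sup>2 * ?f (Some ((a, b), q + 2))) =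
        (\<Sum>m\<in>{(\<alpha>, \<beta>). \<alpha> \<noteq> 0 \<and> \<beta> \<noteq> 0}. if m = (\<alpha>, \<beta>) then (?C \<alpha> \<beta>)\<^sup>2 / ?N\<^sup>2 else 0)"
      by (rule sum.cong) (auto simp: indicator_def)
    also have "\<dots> = (1 - 1 / ?N) * c"
    proof -
      have "(1 - 1 / M) * (d / (M * (M - 1))) = d / M\<^sup>2" if "M > 1" for M d :: real
        using that by (simp add: divide_simps power2_eq_square)
      from this[OF N] show ?thesis by (simp add: c_def)
    qed
    finally show ?thesis
      unfolding exp by (subst mac_sample_from_expectation[OF assms, where M = 1]) simp_all
  qed
  then have "x q = c"
    by (rule contraction_fixed_point[where M = 1]) (use N in \<open>simp_all add: x_def pmf_le_1\<close>)
  then show ?thesis by (simp add: x_def c_def)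
qed

section \<open>Expected number of queries\<close>

text \<open>Capping makes the query count a bounded test function. A run that never stops is charged
  the full cap, so its cost still grows to infinity with \<open>M\<close>.\<close>

definition truncated_queries :: "nat \<Rightarrow> ('a \<times> nat) option \<Rightarrow> nat" where
  "truncated_queries M t = (case t of None \<Rightarrow> M | Some (_, k) \<Rightarrow> min k M)"

text \<open>Monotone convergence: the capped counts increase with \<open>M\<close>, and their
  supremum is the true cost, infinite at \<open>None\<close>.\<close>

lemma expected_queries_le:
  assumes "\<And>M. measure_pmf.expectation p (\<lambda>t. real (truncated_queries M t)) \<le> c"
  shows "expected_queries p \<le> ennreal c"
proof -
  have le: "truncated_queries M t \<le> M" for M and t :: "('a \<times> nat) option"
    by (auto simp: truncated_queries_def split: option.splits)
  have mono: "incseq (\<lambda>M (t :: ('a \<times> nat) option). (of_nat (truncated_queries M t) :: ennreal))"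
    by (rule incseq_SucI) (auto simp: truncated_queries_def le_fun_def split: option.splits)
  have "(case t of None \<Rightarrow> \<infinity> | Some (_, k) \<Rightarrow> of_nat k) \<le>
      (SUP M. (of_nat (truncated_queries M t) :: ennreal))" for t :: "('a \<times> nat) option"
  proof (cases t)
    case None
    then show ?thesis by (simp add: truncated_queries_def ennreal_SUP_of_nat_eq_top)
  next
    case (Some r)
    then show ?thesis
      by (auto simp: truncated_queries_def split: prod.splits intro!: SUP_upper2[where i = "snd r"])
  qed
  then have "expected_queries p \<le> (\<integral>\<^sup>+t. (SUP M. of_nat (truncated_queries M t)) \<partial>p)"
    unfolding expected_queries_def by (intro nn_integral_mono) simp
  also have "\<dots> = (SUP M. \<integral>\<^sup>+t. of_nat (truncated_queries M t) \<partial>p)"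
    using mono by (intro nn_integral_monotone_convergence_SUP) simp_all
  also have "\<dots> \<le> ennreal c"
  proof (rule SUP_least)
    fix M
    have "integrable p (\<lambda>t. real (truncated_queries M t))"
      using le by (intro measure_pmf.integrable_const_bound[where B = M]) simp_all
    then have "(\<integral>\<^sup>+t. of_nat (truncated_queries M t) \<partial>p) =
        ennreal (measure_pmf.expectation p (\<lambda>t. real (truncated_queries M t)))"
      by (simp add: nn_integral_eq_integral ennreal_of_nat_eq_real_of_nat)
    also have "\<dots> \<le> ennreal c"
      by (rule ennreal_leI) (rule assms)
    finally show "(\<integral>\<^sup>+t. of_nat (truncated_queries M t) \<partial>p) \<le> ennreal c" .
  qed
  finally show ?thesis .
qed

lemma expected_queries_mac_sample:
  fixes B :: "bit ^ 'n \<Rightarrow> bit ^ 'n"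
  assumes "bij B"
  shows "expected_queries (mac_sample (basis_op B) w) \<le> ennreal (2 / (1 - 1 / 2 ^ CARD('n)))"
proof (rule expected_queries_le)
  fix M
  let ?E = "\<lambda>q. measure_pmf.expectation (mac_sample_from (basis_op B) w q)"
  let ?f = "\<lambda>t. real (truncated_queries M t)"
  let ?A = "{(\<alpha>, \<beta>). \<alpha> \<noteq> 0 \<and> \<beta> \<noteq> 0} :: ((bit ^ 'n) \<times> (bit ^ 'n)) set"
  define p where "p \<alpha> \<beta> = (masked_autocorrelation B w \<alpha> \<beta>)\<^sup>2 / (2 ^ CARD('n))\<^sup>2" for \<alpha> \<beta>
  define r :: real where "r = 1 / 2 ^ CARD('n)"
  have r: "0 \<le> r" "r < 1"
    by (simp_all add: r_def)
  \<comment> \<open>The expected further cost of the uncapped loop: two queries now, and the same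
    cost again with probability r.\<close>
  define s where "s = 2 / (1 - r)"
  have s: "s = 2 + r * s"
    using r by (simp add: s_def divide_simps)
  have le: "?f t \<le> M" for t :: "(((bit ^ 'n) \<times> (bit ^ 'n)) \<times> nat) option"
    by (auto simp: truncated_queries_def split: option.splits)
  \<comment> \<open>With the constant test function 1 the recursion reads 1 = acceptance probability
    + r.\<close>
  have p_sum: "(\<Sum>(\<alpha>, \<beta>)\<in>?A. p \<alpha> \<beta>) = 1 - r"
    using mac_sample_from_expectation[OF assms, of "\<lambda>_. 1" 1 w 0] by (simp add: p_def r_def)
  \<comment> \<open>The excess over \<open>q + s\<close> contracts. Capping can only lower the cost
    of an accepted pass, hence an inequality.\<close>
  have "?E q ?f - (q + s) \<le> r * (?E (q + 2) ?f - (real (q + 2) + s))" for q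
  proof -
    have bound: "p \<alpha> \<beta> * ?f (Some ((\<alpha>, \<beta>), q + 2)) \<le> p \<alpha> \<beta> * real (q + 2)" for \<alpha> \<beta>
      by (rule mult_left_mono) (simp_all add: truncated_queries_def p_def)
    have "(\<Sum>(\<alpha>, \<beta>)\<in>?A. p \<alpha> \<beta> * ?f (Some ((\<alpha>, \<beta>), q + 2))) \<le> (\<Sum>(\<alpha>, \<beta>)\<in>?A. p \<alpha> \<beta> * (q + 2))"
      by (rule sum_mono) (simp only: split_def bound)
    also have "\<dots> = (1 - r) * (q + 2)"
      unfolding p_sum[symmetric] sum_distrib_right by (simp add: split_def)
    finally have "?E q ?f \<le> (1 - r) * (q + 2) + r * ?E (q + 2) ?f"
      using mac_sample_from_expectation[OF assms _ le, where w = w and q = q] by (simp add: p_def r_def)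
    moreover have "(1 - r) * real (q + 2) = real q + 2 - r * real q - 2 * r"
      by (simp add: algebra_simps)
    moreover have "r * (?E (q + 2) ?f - (real (q + 2) + s)) =
        r * ?E (q + 2) ?f - r * real q - 2 * r - r * s"
      by (simp add: algebra_simps)
    ultimately show ?thesis using s by linarith
  qed
  \<comment> \<open>Here the cap supplies the bound, uniform in q, that the contraction argument
    needs.\<close>
  moreover have "?E q ?f - (q + s) \<le> M" for q
  proof -
    have "?E q ?f \<le> M"
      using le by (intro measure_pmf.integral_le_const measure_pmf.integrable_const_bound[where B = M]) simp_all
    moreover have "0 \<le> s"
      using r by (simp add: s_def)
    ultimately show ?thesis by simp
  qed
  ultimately have "?E 0 ?f - (real 0 + s) \<le> 0"
    using contraction_nonpos[where y = "\<lambda>q. ?E q ?f - (real q + s)"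
        and r = r and d = 2 and M = M and q = 0] r by blast
  then show "measure_pmf.expectation (mac_sample (basis_op B) w) ?f \<le> 2 / (1 - 1 / 2 ^ CARD('n))"
    by (simp add: mac_sample_def r_def s_def)
qed

theorem theorem2:
  fixes B :: "bit ^ 'n \<Rightarrow> bit ^ 'n" and w :: "bit ^ 'n" and N :: real
  assumes "bij B" and "N = 2 ^ CARD('n)"
  shows "(CARD('n) \<ge> 2 \<longrightarrow> expected_queries (mac_sample (basis_op B) w) \<le> 3) \<and>
         (\<forall>((\<alpha>, \<beta>), k) \<in> set_spmf (mac_sample (basis_op B) w). \<alpha> \<noteq> 0 \<and> \<beta> \<noteq> 0) \<and>
         (\<forall>\<alpha> \<beta>. \<alpha> \<noteq> 0 \<and> \<beta> \<noteq> 0 \<longrightarrow>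
            spmf (map_spmf fst (mac_sample (basis_op B) w)) (\<alpha>, \<beta>) =
              (masked_autocorrelation B w \<alpha> \<beta>)\<^sup>2 / (N * (N - 1))) \<and>
         (\<forall>(m, k) \<in> set_pmf (mac_attempt (basis_op B) w). k = 2) \<and>
         (\<forall>\<alpha> \<beta>. pmf (map_pmf fst (mac_attempt (basis_op B) w)) (\<alpha>, \<beta>) =
              (masked_autocorrelation B w \<alpha> \<beta>)\<^sup>2 / N\<^sup>2)"
proof (intro conjI impI allI)
  assume "CARD('n) \<ge> 2"
  then have "(2::real) ^ 2 \<le> 2 ^ CARD('n)"
    by (intro power_increasing) simp_all
  \<comment> \<open>This inequality amounts to N >= 3; for n = 1 its left-hand side would be
    4.\<close>
  then have "2 / (1 - 1 / 2 ^ CARD('n)) \<le> (3 :: real)"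
    by (simp add: field_simps)
  then have "ennreal (2 / (1 - 1 / 2 ^ CARD('n))) \<le> 3"
    by (metis ennreal_leI ennreal_numeral)
  then show "expected_queries (mac_sample (basis_op B) w) \<le> 3"
    using expected_queries_mac_sample[OF assms(1)] by (rule order_trans[rotated])
next
  have "\<alpha> \<noteq> 0 \<and> \<beta> \<noteq> 0" if "((\<alpha>, \<beta>), k) \<in> set_spmf (mac_sample (basis_op B) w)" for \<alpha> \<beta> k
  proof -
    \<comment> \<open>The support is read off the output probabilities, which vanish as soon as one
      mask is zero.\<close>
    have "(\<alpha>, \<beta>) \<in> set_spmf (map_spmf fst (mac_sample (basis_op B) w))"
      using that by force
    then have "spmf (map_spmf fst (mac_sample (basis_op B) w)) (\<alpha>, \<beta>) \<noteq> 0"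
      by (rule in_set_spmf_iff_spmf[THEN iffD1])
    then show ?thesis
      by (simp add: mac_sample_def spmf_mac_sample_from[OF assms(1)] split: if_splits)
  qed
  then show "\<forall>((\<alpha>, \<beta>), k)\<in>set_spmf (mac_sample (basis_op B) w). \<alpha> \<noteq> 0 \<and> \<beta> \<noteq> 0"
    by fast
next
  fix \<alpha> \<beta> :: "bit ^ 'n"
  assume "\<alpha> \<noteq> 0 \<and> \<beta> \<noteq> 0"
  then show "spmf (map_spmf fst (mac_sample (basis_op B) w)) (\<alpha>, \<beta>) =
      (masked_autocorrelation B w \<alpha> \<beta>)\<^sup>2 / (N * (N - 1))"
    by (simp add: mac_sample_def spmf_mac_sample_from[OF assms(1)] assms(2))
next
  show "\<forall>(m, k)\<in>set_pmf (mac_attempt (basis_op B) w). k = 2"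
    by (rule mac_attempt_eq[OF assms(1), of w]) auto
next
  fix \<alpha> \<beta> :: "bit ^ 'n"
  show "pmf (map_pmf fst (mac_attempt (basis_op B) w)) (\<alpha>, \<beta>) =
      (masked_autocorrelation B w \<alpha> \<beta>)\<^sup>2 / N\<^sup>2"
    by (rule mac_attempt_eq[OF assms(1), of w]) (simp add: pmf.map_comp o_def assms(2))
qed

end
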